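(* Let $(X,\tau_1,\tau_2)$ be a $d$-second countable and $p$-normal bitopological space with $\tau_1\subset\tau_2$, such that both $(X,\tau_1)$ and $(X,\tau_2)$ are $T_1$. Suppose $X=Y\cup Z$, where $Y$ and $Z$ are bitopological subspaces with $p\text{-}\mathrm{Ind}\,Y=p\text{-}\mathrm{Ind}\,Z=0$ and at least one of $Y$, $Z$ is 1-open in $X$. Then $p\text{-}\mathrm{Ind}\,X=0$.
   Context: A bitopological space $(X,\tau_1,\tau_2)$ is a set $X$ with two topologies. "$i$-open", "$i$-closed" refer to $\tau_i$; $\mathrm{co}\,\tau_i$ is the family of $\tau_i$-closed sets. A subset $Y\subset X$ is regarded as a bitopological subspace with the induced topologies. $d$-second countable: both $\tau_1$ and $\tau_2$ are second countable. $p$-normal: for every pair of disjoint sets $A,B$ in $X$ with $A$ 1-closed and $B$ 2-closed there are a 2-open set $U$ and a 1-open set $V$ such that $A\subset U$, $B\subset V$, $U\cap V=\varnothing$. $p\text{-}\mathrm{Ind}\,X=0$ means: for every 1-closed set $F$ and every 2-open $U\supset F$ there is $V\in\tau_2\cap\mathrm{co}\,\tau_1$ with $F\subset V\subset U$, and for every 2-closed set $\Phi$ and every 1-open $U\supset\Phi$ there is $V\in\tau_1\cap\mathrm{co}\,\tau_2$ with $\Phi\subset V\subset U$. *)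

theory Defs
  imports "HOL-Analysis.Analysis"
begin

text \<open>
  A bitopological space is a pair of topologies \<open>T1\<close>, \<open>T2\<close> with the same underlying set.
  The bitopological subspace on \<open>Y\<close> is the pair \<open>subtopology T1 Y\<close>, \<open>subtopology T2 Y\<close>.
\<close>

definition bitopological_space :: "'a set \<Rightarrow> 'a topology \<Rightarrow> 'a topology \<Rightarrow> bool" where
  "bitopological_space X T1 T2 \<longleftrightarrow> topspace T1 = X \<and> topspace T2 = X"

definition d_second_countable :: "'a topology \<Rightarrow> 'a topology \<Rightarrow> bool" where
  "d_second_countable T1 T2 \<longleftrightarrow> second_countable T1 \<and> second_countable T2"

definition p_normal :: "'a topology \<Rightarrow> 'a topology \<Rightarrow> bool" where
  "p_normal T1 T2 \<longleftrightarrow>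
     (\<forall>A B. closedin T1 A \<and> closedin T2 B \<and> A \<inter> B = {} \<longrightarrow>
        (\<exists>U V. openin T2 U \<and> openin T1 V \<and> A \<subseteq> U \<and> B \<subseteq> V \<and> U \<inter> V = {}))"

text \<open>
  Here \<open>p_Ind_zero\<close> renders \<open>p-Ind X = 0\<close> as the separation condition alone. It also holds for the
  empty space, to which the inductive definition would assign the value \<open>-1\<close>.
\<close>

definition p_Ind_zero :: "'a topology \<Rightarrow> 'a topology \<Rightarrow> bool" where
  "p_Ind_zero T1 T2 \<longleftrightarrow>
     (\<forall>F U. closedin T1 F \<and> openin T2 U \<and> F \<subseteq> U \<longrightarrow>
        (\<exists>V. openin T2 V \<and> closedin T1 V \<and> F \<subseteq> V \<and> V \<subseteq> U)) \<and>
     (\<forall>F U. closedin T2 F \<and> openin T1 U \<and> F \<subseteq> U \<longrightarrow>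
        (\<exists>V. openin T1 V \<and> closedin T2 V \<and> F \<subseteq> V \<and> V \<subseteq> U))"

end

theory Submission
  imports Defs
begin

text \<open>
  Let \<open>Y\<close> be the 1-open piece. In a \<open>p\<close>-normal \<open>T\<^sub>1\<close> space with second countable \<open>\<tau>\<^sub>2\<close>, a 2-open set is
  a countable union of 1-closed sets, so \<open>X\<close> is the union of the 1-closed set \<open>X - Y \<subseteq> Z\<close> and
  countably many 1-closed subsets of \<open>Y\<close>. Each of these is also 2-closed because \<open>\<tau>\<^sub>1 \<subseteq> \<tau>\<^sub>2\<close>, hence
  inherits \<open>p-Ind = 0\<close>, and the countable closed sum theorem gives the claim. For the sum theorem, a
  disjoint pair (1-closed, 2-closed) is enlarged step by step: at step \<open>n\<close> it swallows a clopen
  splitting of the \<open>n\<close>-th summand and is then fattened by \<open>p\<close>-normality, so that in the limit both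
  sides become open and cover the space.
\<close>

section \<open>Separation of disjoint pairs, and closed subspaces\<close>

lemma p_normalE:
  assumes "p_normal T1 T2" "closedin T1 A" "closedin T2 B" "A \<inter> B = {}"
  obtains U V where "openin T2 U" "openin T1 V" "A \<subseteq> U" "B \<subseteq> V" "U \<inter> V = {}"
  using assms unfolding p_normal_def by meson

text \<open>Passing from \<open>V\<close> to its complement exchanges the two halves of the
  definition, so a single condition on disjoint pairs (1-closed, 2-closed) carries both. The
  constructions below enlarge such pairs.\<close>

lemma p_Ind_zero_iff_separation:
  assumes top: "topspace T1 = topspace T2"
  shows "p_Ind_zero T1 T2 \<longleftrightarrow>
    (\<forall>A B. closedin T1 A \<and> closedin T2 B \<and> A \<inter> B = {} \<longrightarrow>
       (\<exists>V. openin T2 V \<and> closedin T1 V \<and> A \<subseteq> V \<and> V \<inter> B = {}))"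
    (is "_ \<longleftrightarrow> ?sep")
proof
  assume ind: "p_Ind_zero T1 T2"
  show ?sep
  proof (intro allI impI)
    fix A B assume AB: "closedin T1 A \<and> closedin T2 B \<and> A \<inter> B = {}"
    then have "openin T2 (topspace T2 - B)" "A \<subseteq> topspace T2 - B"
      using top closedin_subset by fastforce+
    then obtain V where "openin T2 V" "closedin T1 V" "A \<subseteq> V" "V \<subseteq> topspace T2 - B"
      using ind AB unfolding p_Ind_zero_def by meson
    then show "\<exists>V. openin T2 V \<and> closedin T1 V \<and> A \<subseteq> V \<and> V \<inter> B = {}"
      by blast
  qed
next
  assume sep: ?sep
  show "p_Ind_zero T1 T2"
    unfolding p_Ind_zero_def
  proof (intro conjI allI impI)
    fix F U assume F: "closedin T1 F \<and> openin T2 U \<and> F \<subseteq> U"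
    then have "closedin T2 (topspace T2 - U)" "F \<inter> (topspace T2 - U) = {}"
      by auto
    then obtain V where "openin T2 V" "closedin T1 V" "F \<subseteq> V" "V \<inter> (topspace T2 - U) = {}"
      using sep F by meson
    then show "\<exists>V. openin T2 V \<and> closedin T1 V \<and> F \<subseteq> V \<and> V \<subseteq> U"
      using openin_subset by blast
  next
    fix F U assume F: "closedin T2 F \<and> openin T1 U \<and> F \<subseteq> U"
    then have "closedin T1 (topspace T1 - U)" "(topspace T1 - U) \<inter> F = {}"
      by auto
    then obtain V where V: "openin T2 V" "closedin T1 V" "topspace T1 - U \<subseteq> V" "V \<inter> F = {}"
      using sep F by meson
    have "openin T1 (topspace T1 - V)"
      using V by blast
    moreover have "closedin T2 (topspace T1 - V)"
      using V unfolding top by blast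
    moreover have "F \<subseteq> topspace T1 - V" "topspace T1 - V \<subseteq> U"
      using V F top closedin_subset by blast+
    ultimately show "\<exists>V. openin T1 V \<and> closedin T2 V \<and> F \<subseteq> V \<and> V \<subseteq> U"
      by blast
  qed
qed

text \<open>As \<open>F\<close> is closed in both topologies, sets relatively closed in
  \<open>F\<close> are closed in the whole space; the set separating them there is then intersected
  with \<open>F\<close>.\<close>

lemma p_Ind_zero_closed_subspace:
  assumes top: "topspace T1 = topspace T2"
    and ind: "p_Ind_zero T1 T2"
    and F: "closedin T1 F" "closedin T2 F"
  shows "p_Ind_zero (subtopology T1 F) (subtopology T2 F)"
proof (subst p_Ind_zero_iff_separation)
  show "topspace (subtopology T1 F) = topspace (subtopology T2 F)"
    using top by simp
  show "\<forall>A B. closedin (subtopology T1 F) A \<and> closedin (subtopology T2 F) B \<and> A \<inter> B = {} \<longrightarrow>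
    (\<exists>V. openin (subtopology T2 F) V \<and> closedin (subtopology T1 F) V \<and> A \<subseteq> V \<and> V \<inter> B = {})"
  proof (intro allI impI)
    fix A B
    assume AB: "closedin (subtopology T1 F) A \<and> closedin (subtopology T2 F) B \<and> A \<inter> B = {}"
    then have "closedin T1 A" "closedin T2 B" and AF: "A \<subseteq> F"
      using F closedin_closed_subtopology by metis+
    then obtain V where V: "openin T2 V" "closedin T1 V" "A \<subseteq> V" "V \<inter> B = {}"
      using ind AB unfolding p_Ind_zero_iff_separation[OF top] by meson
    have "openin (subtopology T2 F) (F \<inter> V)" "closedin (subtopology T1 F) (F \<inter> V)"
      using V by (auto simp: openin_subtopology_Int2 closedin_subtopology)
    then show "\<exists>V. openin (subtopology T2 F) V \<and> closedin (subtopology T1 F) V \<and> A \<subseteq> V \<and> V \<inter> B = {}"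
      using V AF by blast
  qed
qed

section \<open>Enlarging a disjoint pair by \<open>p\<close>-normality\<close>

lemma p_normal_fatten:
  assumes top: "topspace T1 = topspace T2" and normal: "p_normal T1 T2"
    and AB: "closedin T1 A" "closedin T2 B" "A \<inter> B = {}"
  obtains A' B' where "closedin T1 A'" "closedin T2 B'" "A' \<inter> B' = {}"
    "A \<subseteq> T2 interior_of A'" "B \<subseteq> T1 interior_of B'"
proof -
  obtain U V where UV: "openin T2 U" "openin T1 V" "A \<subseteq> U" "B \<subseteq> V" "U \<inter> V = {}"
    using p_normalE[OF normal AB] .
  \<comment> \<open>The complement of \<open>V\<close> is 1-closed, contains the 2-open set
    \<open>U\<close> around \<open>A\<close> and still misses \<open>B\<close>. So
    \<open>p\<close>-normality applies a second time, now to \<open>A'\<close> and \<open>B\<close>,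
    and the complement of \<open>U'\<close> serves as \<open>B'\<close>.\<close>
  define A' where "A' = topspace T1 - V"
  have "closedin T1 A'" "A' \<inter> B = {}"
    using UV by (auto simp: A'_def)
  then obtain U' V' where UV': "openin T2 U'" "openin T1 V'" "A' \<subseteq> U'" "B \<subseteq> V'" "U' \<inter> V' = {}"
    using p_normalE[OF normal _ AB(2)] by metis
  define B' where "B' = topspace T2 - U'"
  have "U \<subseteq> A'" "V' \<subseteq> B'"
    using UV UV' top openin_subset unfolding A'_def B'_def by blast+
  then have "A \<subseteq> T2 interior_of A'" "B \<subseteq> T1 interior_of B'"
    using UV UV' interior_of_maximal by (metis subset_trans)+
  moreover have "closedin T2 B'" "A' \<inter> B' = {}"
    using UV' by (auto simp: B'_def)
  ultimately show thesis
    using that \<open>closedin T1 A'\<close> by blast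
qed

text \<open>The hypothesis on \<open>F\<close> splits it into \<open>P\<close> and
  \<open>F - P\<close>, separating the traces of \<open>A\<close> and \<open>B\<close>. Since
  \<open>F\<close> is closed in both topologies, \<open>P\<close> is 1-closed and
  \<open>F - P\<close> is 2-closed in the whole space. Adding them to \<open>A\<close> and
  \<open>B\<close> keeps the pair disjoint, and the larger pair is then fattened.\<close>

lemma p_Ind_zero_absorb:
  assumes top: "topspace T1 = topspace T2" and normal: "p_normal T1 T2"
    and F: "closedin T1 F" "closedin T2 F"
    and ind: "p_Ind_zero (subtopology T1 F) (subtopology T2 F)"
    and AB: "closedin T1 A" "closedin T2 B" "A \<inter> B = {}"
  obtains A' B' where "closedin T1 A'" "closedin T2 B'" "A' \<inter> B' = {}"
    "A \<subseteq> T2 interior_of A'" "B \<subseteq> T1 interior_of B'" "F \<subseteq> A' \<union> B'"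
proof -
  have topF: "topspace (subtopology T1 F) = topspace (subtopology T2 F)"
    using top by simp
  have "closedin (subtopology T1 F) (F \<inter> A)" "closedin (subtopology T2 F) (F \<inter> B)"
    using AB by (auto simp: closedin_subtopology)
  moreover have "(F \<inter> A) \<inter> (F \<inter> B) = {}"
    using AB by blast
  ultimately obtain P where P: "openin (subtopology T2 F) P" "closedin (subtopology T1 F) P"
      "F \<inter> A \<subseteq> P" "P \<inter> (F \<inter> B) = {}"
    using ind unfolding p_Ind_zero_iff_separation[OF topF] by meson
  have "topspace (subtopology T2 F) = F"
    using F closedin_subset by force
  then have "closedin (subtopology T2 F) (F - P)"
    using P(1) by (metis closedin_diff closedin_topspace)
  then have "closedin T2 (F - P)" "closedin T1 P" and PF: "P \<subseteq> F"
    using F P(2) closedin_closed_subtopology by metis+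
  then have "closedin T1 (A \<union> P)" "closedin T2 (B \<union> (F - P))"
    using AB by auto
  moreover have "(A \<union> P) \<inter> (B \<union> (F - P)) = {}"
    using AB P PF by blast
  ultimately obtain A' B' where A'B': "closedin T1 A'" "closedin T2 B'" "A' \<inter> B' = {}"
      "A \<union> P \<subseteq> T2 interior_of A'" "B \<union> (F - P) \<subseteq> T1 interior_of B'"
    using p_normal_fatten[OF top normal] by metis
  moreover have "F \<subseteq> A' \<union> B'"
    using A'B' interior_of_subset by fast
  ultimately show thesis
    using that by simp
qed

section \<open>The countable closed sum theorem\<close>

theorem p_Ind_zero_countable_closed_sum:
  fixes F :: "nat \<Rightarrow> 'a set"
  assumes top: "topspace T1 = topspace T2" and normal: "p_normal T1 T2"
    and F: "\<And>n. closedin T1 (F n)" "\<And>n. closedin T2 (F n)"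
    and ind: "\<And>n. p_Ind_zero (subtopology T1 (F n)) (subtopology T2 (F n))"
    and cover: "topspace T1 \<subseteq> (\<Union>n. F n)"
  shows "p_Ind_zero T1 T2"
  unfolding p_Ind_zero_iff_separation[OF top]
proof (intro allI impI)
  fix A B assume AB: "closedin T1 A \<and> closedin T2 B \<and> A \<inter> B = {}"
  define good where "good = (\<lambda>(C, D). closedin T1 C \<and> closedin T2 D \<and> C \<inter> D = {})"
  define step where "step = (\<lambda>(n::nat) (C, D) (C', D').
    C \<subseteq> T2 interior_of C' \<and> D \<subseteq> T1 interior_of D' \<and> F n \<subseteq> C' \<union> D')"
  \<comment> \<open>Dependent choice leaves the first term free; the conjunct for
    \<open>n = 0\<close> forces the sequence to start at \<open>(A, B)\<close>.\<close>
  have "\<exists>f. \<forall>n. (good (f n) \<and> (n = 0 \<longrightarrow> f n = (A, B))) \<and> step n (f n) (f (Suc n))"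
  proof (rule dependent_nat_choice)
    show "\<exists>x. good x \<and> (0 = (0::nat) \<longrightarrow> x = (A, B))"
      using AB by (auto simp: good_def)
  next
    fix x :: "'a set \<times> 'a set" and n :: nat
    assume "good x \<and> (n = 0 \<longrightarrow> x = (A, B))"
    then obtain C D where x: "x = (C, D)" "closedin T1 C" "closedin T2 D" "C \<inter> D = {}"
      by (cases x) (auto simp: good_def)
    obtain C' D' where "closedin T1 C'" "closedin T2 D'" "C' \<inter> D' = {}"
      "C \<subseteq> T2 interior_of C'" "D \<subseteq> T1 interior_of D'" "F n \<subseteq> C' \<union> D'"
      using p_Ind_zero_absorb[OF top normal F ind x(2-4)] .
    then show "\<exists>y. (good y \<and> (Suc n = 0 \<longrightarrow> y = (A, B))) \<and> step n x y"
      by (intro exI[of _ "(C', D')"]) (auto simp: good_def step_def x)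
  qed
  then obtain f where f: "\<And>n. good (f n)" "f 0 = (A, B)" "\<And>n. step n (f n) (f (Suc n))"
    by auto
  define C where "C n = fst (f n)" for n
  define D where "D n = snd (f n)" for n
  have disj: "C n \<inter> D n = {}" for n
    using f(1)[of n] by (auto simp: good_def C_def D_def split: prod.splits)
  have fat: "C n \<subseteq> T2 interior_of C (Suc n)" "D n \<subseteq> T1 interior_of D (Suc n)"
      "F n \<subseteq> C (Suc n) \<union> D (Suc n)" for n
    using f(3)[of n] by (auto simp: step_def C_def D_def split: prod.splits)
  have "incseq C" "incseq D"
    using fat interior_of_subset by (metis incseq_SucI subset_trans)+
  \<comment> \<open>Sets from different stages are compared at the later stage, which contains
    both.\<close>
  have disjoint: "C m \<inter> D n = {}" for m n
    using disj[of "max m n"] incseqD[OF \<open>incseq C\<close>, of m "max m n"]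
      incseqD[OF \<open>incseq D\<close>, of n "max m n"] by auto
  \<comment> \<open>Each stage lies in the interior of the next, so replacing all stages by their
    interiors leaves the union unchanged. This makes the \<open>C\<close> side 2-open and the
    \<open>D\<close> side 1-open.\<close>
  have C_eq: "(\<Union>n. C n) = (\<Union>n. T2 interior_of C n)"
    by (rule SUP_eq) (meson fat(1) interior_of_subset UNIV_I)+
  have D_eq: "(\<Union>n. D n) = (\<Union>n. T1 interior_of D n)"
    by (rule SUP_eq) (meson fat(2) interior_of_subset UNIV_I)+
  have C_open: "openin T2 (\<Union>n. C n)" and D_open: "openin T1 (\<Union>n. D n)"
    unfolding C_eq D_eq by auto
  have "topspace T1 \<subseteq> (\<Union>n. C n) \<union> (\<Union>n. D n)"
  proof
    fix x assume "x \<in> topspace T1"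
    then obtain n where "x \<in> F n"
      using cover by blast
    then show "x \<in> (\<Union>n. C n) \<union> (\<Union>n. D n)"
      using fat(3)[of n] by blast
  qed
  moreover have "(\<Union>n. C n) \<subseteq> topspace T1"
    using openin_subset[OF C_open] top by simp
  moreover have "(\<Union>n. C n) \<inter> (\<Union>n. D n) = {}"
    using disjoint by blast
  \<comment> \<open>The two sides are complementary, so 1-openness of the \<open>D\<close> side
    makes the \<open>C\<close> side 1-closed.\<close>
  ultimately have "(\<Union>n. C n) = topspace T1 - (\<Union>n. D n)"
    by blast
  then have "closedin T1 (\<Union>n. C n)"
    using D_open closedin_diff[OF closedin_topspace] by metis
  moreover have "C 0 = A" "D 0 = B"
    using f(2) by (simp_all add: C_def D_def)
  then have "A \<subseteq> (\<Union>n. C n)" "(\<Union>n. C n) \<inter> B = {}"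
    using disjoint[of _ 0] by auto
  ultimately show "\<exists>V. openin T2 V \<and> closedin T1 V \<and> A \<subseteq> V \<and> V \<inter> B = {}"
    using C_open by blast
qed

section \<open>Open sets as countable unions of closed sets, and the union of two subspaces\<close>

lemma p_normal_open_eq_countable_Union_closed:
  assumes top: "topspace T1 = topspace T2" and normal: "p_normal T1 T2"
    and "t1_space T1" "second_countable T2" and Y: "openin T2 Y"
  obtains \<F> where "countable \<F>" "\<And>F. F \<in> \<F> \<Longrightarrow> closedin T1 F" "\<Union>\<F> = Y"
proof -
  obtain \<B> where "countable \<B>" and base: "\<And>U x. openin T2 U \<Longrightarrow> x \<in> U \<Longrightarrow> \<exists>V\<in>\<B>. x \<in> V \<and> V \<subseteq> U"
    using \<open>second_countable T2\<close> unfolding second_countable_def by metis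
  \<comment> \<open>These are the 1-closures of basic 2-open sets that fit into \<open>Y\<close>.
    They cover \<open>Y\<close>: separate the 1-closed \<open>{x}\<close> from the 2-closed
    complement of \<open>Y\<close>; a basic set around \<open>x\<close> inside \<open>U\<close>
    misses the 1-open \<open>V\<close>, hence so does its 1-closure, which therefore stays in
    \<open>Y\<close>.\<close>
  define \<F> where "\<F> = {F \<in> (closure_of) T1 ` \<B>. F \<subseteq> Y}"
  have "x \<in> \<Union>\<F>" if "x \<in> Y" for x
  proof -
    have "x \<in> topspace T1"
      using that Y top openin_subset by blast
    then have "closedin T1 {x}"
      using \<open>t1_space T1\<close> by (simp add: t1_space_closedin_singleton)
    then obtain U V where UV: "openin T2 U" "openin T1 V" "{x} \<subseteq> U" "topspace T2 - Y \<subseteq> V" "U \<inter> V = {}"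
      using p_normalE[OF normal, of "{x}" "topspace T2 - Y"] Y \<open>x \<in> Y\<close> by blast
    then obtain W where W: "W \<in> \<B>" "x \<in> W" "W \<subseteq> U"
      using base by blast
    have "W \<subseteq> topspace T1 - V"
      using W UV openin_subset[OF UV(1)] top by blast
    then have "T1 closure_of W \<subseteq> topspace T1 - V"
      using UV by (intro closure_of_minimal) auto
    then have "T1 closure_of W \<in> \<F>"
      using UV W top by (auto simp: \<F>_def)
    moreover have "x \<in> T1 closure_of W"
      using W \<open>x \<in> topspace T1\<close> by (auto simp: in_closure_of)
    ultimately show ?thesis by blast
  qed
  then have "\<Union>\<F> = Y"
    by (auto simp: \<F>_def)
  moreover have "countable \<F>" "\<And>F. F \<in> \<F> \<Longrightarrow> closedin T1 F"
    using \<open>countable \<B>\<close> by (auto simp: \<F>_def)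
  ultimately show thesis
    using that by blast
qed

lemma p_Ind_zero_Un_open:
  assumes top: "topspace T1 = topspace T2" and "p_normal T1 T2"
    and "t1_space T1" "second_countable T2"
    and finer: "\<And>U. openin T1 U \<Longrightarrow> openin T2 U"
    and cover: "topspace T1 = Y \<union> Z"
    and Y: "p_Ind_zero (subtopology T1 Y) (subtopology T2 Y)"
    and Z: "p_Ind_zero (subtopology T1 Z) (subtopology T2 Z)"
    and "openin T1 Y"
  shows "p_Ind_zero T1 T2"
proof -
  have finer_closed: "closedin T2 C" if "closedin T1 C" for C
    using that finer top by (simp add: closedin_def)
  have closed_part: "p_Ind_zero (subtopology T1 F) (subtopology T2 F)"
    if "closedin T1 F" "F \<subseteq> S" "p_Ind_zero (subtopology T1 S) (subtopology T2 S)" for F S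
  proof -
    have "closedin (subtopology T1 S) F" "closedin (subtopology T2 S) F"
      using that finer_closed by (simp_all add: closedin_subset_topspace)
    moreover have "topspace (subtopology T1 S) = topspace (subtopology T2 S)"
      using top by simp
    ultimately show ?thesis
      using p_Ind_zero_closed_subspace that by (metis subtopology_subtopology inf.absorb2)
  qed
  obtain \<F> where \<F>: "countable \<F>" "\<And>F. F \<in> \<F> \<Longrightarrow> closedin T1 F" "\<Union>\<F> = Y"
    using p_normal_open_eq_countable_Union_closed assms(1-4) finer[OF \<open>openin T1 Y\<close>] by metis
  \<comment> \<open>The complement of \<open>Y\<close> lies in \<open>Z\<close> and completes the
    cover. Its insertion also makes \<G> nonempty, so that \<open>from_nat_into\<close> enumerates
    exactly \<G>, possibly with repetitions.\<close>
  define \<G> where "\<G> = insert (topspace T1 - Y) \<F>"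
  define G where "G = from_nat_into \<G>"
  have range: "range G = \<G>"
    using \<F>(1) unfolding G_def \<G>_def by (intro range_from_nat_into) auto
  have closed: "closedin T1 C" if "C \<in> \<G>" for C
    using that \<F>(2) \<open>openin T1 Y\<close> by (auto simp: \<G>_def)
  have ind: "p_Ind_zero (subtopology T1 C) (subtopology T2 C)" if "C \<in> \<G>" for C
  proof -
    have "C \<subseteq> Y \<or> C \<subseteq> Z"
      using that \<F>(3) cover by (auto simp: \<G>_def)
    then show ?thesis
      using closed_part closed[OF that] Y Z by blast
  qed
  show ?thesis
  proof (rule p_Ind_zero_countable_closed_sum[OF top \<open>p_normal T1 T2\<close>])
    show "closedin T1 (G n)" "closedin T2 (G n)"
      "p_Ind_zero (subtopology T1 (G n)) (subtopology T2 (G n))" for n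
      using range closed ind finer_closed by blast+
    show "topspace T1 \<subseteq> (\<Union>n. G n)"
      unfolding range using \<F>(3) by (auto simp: \<G>_def)
  qed
qed

theorem corollary2p27:
  fixes X Y Z :: "'a set" and T1 T2 :: "'a topology"
  assumes "bitopological_space X T1 T2"
    and "d_second_countable T1 T2"
    and "p_normal T1 T2"
    and "\<And>U. openin T1 U \<Longrightarrow> openin T2 U"
    and "t1_space T1" and "t1_space T2"
    and "X = Y \<union> Z"
    and "p_Ind_zero (subtopology T1 Y) (subtopology T2 Y)"
    and "p_Ind_zero (subtopology T1 Z) (subtopology T2 Z)"
    and "openin T1 Y \<or> openin T1 Z"
  shows "p_Ind_zero T1 T2"
proof -
  \<comment> \<open>The cover is recorded in both orders so that either piece can play the part of
    the 1-open one.\<close>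
  have top: "topspace T1 = topspace T2" "topspace T1 = Y \<union> Z" "topspace T1 = Z \<union> Y"
    using assms(1,7) by (auto simp: bitopological_space_def)
  have "second_countable T2"
    using assms(2) by (simp add: d_second_countable_def)
  note Un_open = p_Ind_zero_Un_open[OF top(1) assms(3,5) this assms(4)]
  from assms(10) show ?thesis
    using Un_open[OF _ top(2) assms(8,9)] Un_open[OF _ top(3) assms(9,8)] by blast
qed

end
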